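(* Let $\mathbb{F}$ be a field and let $G$ be a group with an $\mathbb{F}$-nilpotent normal subgroup $N$ such that $G = H \ltimes N$ (internal semidirect product) for some subgroup $H \leq G$. Suppose the conjugation action of $G$ on $N$ is $\mathbb{F}$-linear. Let $x \in H$ be a non-identity element, and assume that the action of $x$ on $N$ by conjugation has no nonzero fixed point. Then: \begin{enumerate} \item if $x$ is real in $H$, then $xn$ is real in $G$ for all $n \in N$; \item if $x$ is rational in $H$, then $xn$ is rational in $G$ for all $n \in N$. \end{enumerate}
   Context: An element $g$ of a group $G$ is \emph{real} in $G$ if it is conjugate in $G$ to $g^{-1}$. It is \emph{rational} in $G$ if every $y \in G$ with $\langle y\rangle = \langle g\rangle$ is $G$-conjugate to $g$; equivalently, if $g$ has finite order, $g$ is conjugate to $g^k$ for every integer $k$ coprime to the order of $g$ (and if $g$ has infinite order, rational means the same as real). A nilpotent group $N$ is \emph{$\mathbb{F}$-nilpotent} if, writing $N = N_0 \triangleright N_1 \triangleright \cdots \triangleright N_r = \{e\}$ for its (descending) central series, i.e. $N_{j+1} = [N,N_j]$, each quotient $N_j/N_{j+1}$ is a finite-dimensional vector space over $\mathbb{F}$ (with vector addition given by the group operation). If a group $G$ acts on an $\mathbb{F}$-nilpotent group $N$ by automorphisms, the action is \emph{$\mathbb{F}$-linear} if for each $j$ the induced action of $G$ on $N_j/N_{j+1}$ is $\mathbb{F}$-linear. For $x \in G$, the action of $x$ on $N$ \emph{has no nonzero fixed points} if for each $j$ the induced action of $x$ on $N_j/N_{j+1}$ fixes only the zero element. *)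

theory Defs
  imports "HOL-Algebra.Algebra" "Jordan_Normal_Form.Missing_VectorSpace"
begin

definition conjugate_in :: "('a, 'b) monoid_scheme \<Rightarrow> 'a \<Rightarrow> 'a \<Rightarrow> bool" where
  "conjugate_in G a b \<longleftrightarrow> (\<exists>h\<in>carrier G. b = h \<otimes>\<^bsub>G\<^esub> a \<otimes>\<^bsub>G\<^esub> inv\<^bsub>G\<^esub> h)"

definition real_in :: "('a, 'b) monoid_scheme \<Rightarrow> 'a \<Rightarrow> bool" where
  "real_in G g \<longleftrightarrow> g \<in> carrier G \<and> conjugate_in G g (inv\<^bsub>G\<^esub> g)"

definition rational_in :: "('a, 'b) monoid_scheme \<Rightarrow> 'a \<Rightarrow> bool" where
  "rational_in G g \<longleftrightarrow> g \<in> carrier G \<and>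
     (\<forall>y\<in>carrier G. generate G {y} = generate G {g} \<longrightarrow> conjugate_in G y g)"

definition commutator_subgroup ::
    "('a, 'b) monoid_scheme \<Rightarrow> 'a set \<Rightarrow> 'a set \<Rightarrow> 'a set" where
  "commutator_subgroup G A B =
     generate G (\<Union>a\<in>A. \<Union>b\<in>B. {a \<otimes>\<^bsub>G\<^esub> b \<otimes>\<^bsub>G\<^esub> inv\<^bsub>G\<^esub> a \<otimes>\<^bsub>G\<^esub> inv\<^bsub>G\<^esub> b})"

primrec lower_central :: "('a, 'b) monoid_scheme \<Rightarrow> nat \<Rightarrow> 'a set" where
  "lower_central N 0 = carrier N"
| "lower_central N (Suc j) = commutator_subgroup N (carrier N) (lower_central N j)"

definition nilpotent_group :: "('a, 'b) monoid_scheme \<Rightarrow> bool" where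
  "nilpotent_group N \<longleftrightarrow> group N \<and> (\<exists>r. lower_central N r = {\<one>\<^bsub>N\<^esub>})"

definition nilpotency_class :: "('a, 'b) monoid_scheme \<Rightarrow> nat" where
  "nilpotency_class N = (LEAST r. lower_central N r = {\<one>\<^bsub>N\<^esub>})"

definition central_factor :: "('a, 'b) monoid_scheme \<Rightarrow> nat \<Rightarrow> 'a set monoid" where
  "central_factor N j = (N\<lparr>carrier := lower_central N j\<rparr>) Mod (lower_central N (Suc j))"

text \<open>
  The vector space structures on the factors of the central series are data, not determined by
  the group: \<open>s j\<close> is the scalar multiplication on the \<open>j\<close>-th factor. Vector addition is the group
  operation of the factor. The multiplicative part of the \<open>module\<close> record is not constrained by
  \<open>vectorspace\<close>; the group operation is put there merely as a filler.
\<close>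

definition factor_space ::
    "('a, 'b) monoid_scheme \<Rightarrow> (nat \<Rightarrow> 'f \<Rightarrow> 'a set \<Rightarrow> 'a set) \<Rightarrow> nat \<Rightarrow> ('f, 'a set) module" where
  "factor_space N s j =
     (let Q = central_factor N j in
      \<lparr>carrier = carrier Q, monoid.mult = (\<otimes>\<^bsub>Q\<^esub>), one = \<one>\<^bsub>Q\<^esub>,
       ring.zero = \<one>\<^bsub>Q\<^esub>, ring.add = (\<otimes>\<^bsub>Q\<^esub>), module.smult = s j\<rparr>)"

definition F_nilpotent ::
    "('f, 'm) ring_scheme \<Rightarrow> ('a, 'b) monoid_scheme \<Rightarrow> (nat \<Rightarrow> 'f \<Rightarrow> 'a set \<Rightarrow> 'a set) \<Rightarrow> bool" where
  "F_nilpotent F N s \<longleftrightarrow> nilpotent_group N \<and>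
     (\<forall>j<nilpotency_class N.
        vectorspace F (factor_space N s j) \<and> vectorspace.fin_dim F (factor_space N s j))"

text \<open>
  Below, \<open>\<phi> g\<close> is the automorphism of \<open>N\<close> by which \<open>g\<close> acts. An automorphism preserves each term
  of the central series, so the map it induces on a factor sends a coset to its image.
\<close>

definition F_linear_action ::
    "('f, 'm) ring_scheme \<Rightarrow> ('g, 'c) monoid_scheme \<Rightarrow> ('a, 'b) monoid_scheme \<Rightarrow>
     (nat \<Rightarrow> 'f \<Rightarrow> 'a set \<Rightarrow> 'a set) \<Rightarrow> ('g \<Rightarrow> 'a \<Rightarrow> 'a) \<Rightarrow> bool" where
  "F_linear_action F G N s \<phi> \<longleftrightarrow>
     (\<forall>g\<in>carrier G. \<forall>j<nilpotency_class N.
        linear_map F (factor_space N s j) (factor_space N s j) (\<lambda>W. \<phi> g ` W))"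

definition no_nonzero_fixed_points ::
    "('a, 'b) monoid_scheme \<Rightarrow> ('a \<Rightarrow> 'a) \<Rightarrow> bool" where
  "no_nonzero_fixed_points N f \<longleftrightarrow>
     (\<forall>j<nilpotency_class N. \<forall>W\<in>carrier (central_factor N j).
        f ` W = W \<longrightarrow> W = \<one>\<^bsub>central_factor N j\<^esub>)"

definition internal_semidirect :: "('a, 'b) monoid_scheme \<Rightarrow> 'a set \<Rightarrow> 'a set \<Rightarrow> bool" where
  "internal_semidirect G H N \<longleftrightarrow>
     subgroup H G \<and> N \<lhd> G \<and> H \<inter> N = {\<one>\<^bsub>G\<^esub>} \<and> H <#>\<^bsub>G\<^esub> N = carrier G"

definition conj_action :: "('a, 'b) monoid_scheme \<Rightarrow> 'a \<Rightarrow> 'a \<Rightarrow> 'a" where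
  "conj_action G g n = g \<otimes>\<^bsub>G\<^esub> n \<otimes>\<^bsub>G\<^esub> inv\<^bsub>G\<^esub> g"

end

theory Submission
  imports Defs
begin

text \<open>
  Everything rests on one fact: every element of the coset \<open>x N\<close> is conjugate to \<open>x\<close>, so that
  it suffices to treat \<open>x\<close> itself.

  The fact is proved by moving down the central series \<open>L\<close> of \<open>N\<close>. Suppose that \<open>x n\<close> has been
  conjugated to \<open>x a\<close> with \<open>a \<in> L j\<close>. For \<open>u \<in> L j\<close> the element \<open>m = x u x\<inverse>\<close> satisfies
  \<open>m (x a) m\<inverse> = x (u a m\<inverse>)\<close>, which lies in \<open>x L (j + 1)\<close> as soon as \<open>f u = u + a\<close> on the
  factor \<open>L j / L (j + 1)\<close>, where \<open>f\<close> is the linear map induced by \<open>x\<close>. Such a \<open>u\<close> exists because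
  \<open>f - id\<close> is an endomorphism of a finite-dimensional space, injective since \<open>x\<close> has no nonzero
  fixed points, and therefore surjective. After finitely many steps the error term is trivial.

  Reality and rationality are invariant under conjugation, so it remains to pass from \<open>H\<close> to \<open>G\<close>
  for \<open>x\<close> itself. For reality this is clear. For rationality, a generator \<open>y\<close> of the cyclic group
  of \<open>x\<close> already lies in \<open>H\<close>, where it is conjugate to \<open>x\<close> by assumption.
\<close>

section \<open>Fixed-point-free endomorphisms\<close>

text \<open>
  An injective \<open>T\<close> is an isomorphism onto its image, so it carries a basis to a linearly
  independent set with as many elements as the dimension. Such a set spans the whole space.
\<close>

lemma inj_endomorphism_imp_surj:
  assumes lin: "linear_map K V V T" and fd: "vectorspace.fin_dim K V"
    and inj: "inj_on T (carrier V)"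
  shows "T ` carrier V = carrier V"
proof -
  interpret linear_map K V V T by (rule lin)
  define U where "U = V.vs imT"
  have sub: "subspace K imT V" by (rule imT_is_subspace)
  have "vectorspace K U" unfolding U_def by (rule V.subspace_is_vs[OF sub])
  then interpret U: vectorspace K U .
  have hom: "T \<in> module_hom K V U"
    using f_hom unfolding module_hom_def U_def im_def by auto
  interpret TU: linear_map K V U T
    by (intro linear_map.intro mod_hom.intro mod_hom_axioms.intro)
       (use V.vectorspace_axioms U.vectorspace_axioms vectorspace.axioms(1)[OF V.vectorspace_axioms] vectorspace.axioms(1)[OF U.vectorspace_axioms] hom in auto)
  have surj: "T ` carrier V = carrier U" by (simp add: U_def im_def)
  obtain B where B: "finite B" "V.basis B" using V.finite_basis_exists[OF fd] by auto
  have UB: "U.basis (T ` B)"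
    by (rule TU.linear_inj_image_is_basis[OF inj surj B(2) fd])
  have BV: "B \<subseteq> carrier V" using B(2) unfolding V.basis_def by auto
  have TB: "T ` B \<subseteq> imT" using BV by (auto simp: im_def)
  have imV: "imT \<subseteq> carrier V" by (auto simp: im_def)
  have li: "V.module.lin_indpt (T ` B)"
    using UB unfolding U.basis_def
    using V.module.span_li_not_depend(2)[OF TB V.is_module[OF sub]] unfolding U_def by blast
  have card: "card (T ` B) = V.dim"
    using V.dim_basis[OF B] card_image[OF inj_on_subset[OF inj BV]] by simp
  have "V.basis (T ` B)"
    by (rule V.dim_li_is_basis[OF fd]) (use B li card TB imV in auto)
  then have "V.module.span (T ` B) = carrier V" unfolding V.basis_def by auto
  moreover have "V.module.span (T ` B) \<subseteq> imT"
    using V.module.span_is_subset[OF TB V.is_module[OF sub]] .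
  ultimately show ?thesis using imV by (auto simp: im_def)
qed

text \<open>The kernel of \<open>T - id\<close> is the space of fixed points, so \<open>T - id\<close> is onto.\<close>

lemma fixed_point_free_imp_displacement_surj:
  assumes lin: "linear_map K V V T" and fd: "vectorspace.fin_dim K V"
    and fix0: "\<And>v. v \<in> carrier V \<Longrightarrow> T v = v \<Longrightarrow> v = \<zero>\<^bsub>V\<^esub>"
    and a: "a \<in> carrier V"
  shows "\<exists>v\<in>carrier V. T v = v \<oplus>\<^bsub>V\<^esub> a"
proof -
  interpret linear_map K V V T by (rule lin)
  define D where "D = (\<lambda>v. T v \<ominus>\<^bsub>V\<^esub> v)"
  have hom: "D \<in> module_hom K V V"
    unfolding module_hom_def D_def
    by (auto simp: V.module.M.minus_eq V.module.M.minus_add V.module.M.a_ac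
          V.module.smult_r_distr V.module.smult_r_minus)
  interpret D: linear_map K V V D
    by (intro linear_map.intro mod_hom.intro mod_hom_axioms.intro)
       (use V.vectorspace_axioms vectorspace.axioms(1)[OF V.vectorspace_axioms] hom in auto)
  have ker: "D.kerT = {\<zero>\<^bsub>V\<^esub>}"
  proof -
    have "v = \<zero>\<^bsub>V\<^esub>" if "v \<in> carrier V" "D v = \<zero>\<^bsub>V\<^esub>" for v
      using fix0[OF that(1)] that V.module.M.minus_other_side[of "T v" v] unfolding D_def by auto
    then show ?thesis unfolding D.ker_def by auto
  qed
  then have "inj_on D (carrier V)" using D.Ke0_imp_inj by simp
  then have "D ` carrier V = carrier V" using inj_endomorphism_imp_surj[OF D.linear_map_axioms fd] by blast
  then obtain v where v: "v \<in> carrier V" "D v = a" using a by (metis imageE)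
  then have "T v = v \<oplus>\<^bsub>V\<^esub> a"
    using V.module.M.a_lcomm[of v "T v" "\<ominus>\<^bsub>V\<^esub> v"]
    by (auto simp: D_def V.module.M.minus_eq V.module.M.r_neg)
  then show ?thesis using v by blast
qed

section \<open>The central series of a normal subgroup\<close>

context group
begin

lemma inv_cancel_left:
  assumes "c \<in> carrier G" "z \<in> carrier G"
  shows "inv c \<otimes> (c \<otimes> z) = z" "c \<otimes> (inv c \<otimes> z) = z"
  using assms by (simp_all add: m_assoc[symmetric])

lemma conj_commutator:
  assumes "g \<in> carrier G" "a \<in> carrier G" "b \<in> carrier G"
  shows "g \<otimes> (a \<otimes> b \<otimes> inv a \<otimes> inv b) \<otimes> inv g =
    (g \<otimes> a \<otimes> inv g) \<otimes> (g \<otimes> b \<otimes> inv g) \<otimes> inv (g \<otimes> a \<otimes> inv g) \<otimes> inv (g \<otimes> b \<otimes> inv g)"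
  using assms by (simp add: inv_mult_group m_assoc inv_cancel_left)

lemma normal_conj_closed:
  assumes "M \<lhd> G" "g \<in> carrier G" "h \<in> M"
  shows "g \<otimes> h \<otimes> inv g \<in> M"
  using assms normal_inv_iff by blast

lemma commutator_subgroup_normal:
  assumes N: "N \<lhd> G" and A: "A \<lhd> G" and AN: "A \<subseteq> N"
  shows "commutator_subgroup (G\<lparr>carrier := N\<rparr>) N A \<lhd> G"
    and "commutator_subgroup (G\<lparr>carrier := N\<rparr>) N A \<subseteq> A"
proof -
  have sN: "subgroup N G" and sA: "subgroup A G"
    using N A by (auto dest: normal_imp_subgroup)
  let ?S = "\<Union>a\<in>N. \<Union>b\<in>A. {a \<otimes> b \<otimes> inv a \<otimes> inv b}"
  have SA: "?S \<subseteq> A"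
    using normal_conj_closed[OF A] subgroup.mem_carrier[OF sN]
      subgroup.m_closed[OF sA] subgroup.m_inv_closed[OF sA] by auto
  have "(\<Union>a\<in>N. \<Union>b\<in>A. {a \<otimes> b \<otimes> inv\<^bsub>G\<lparr>carrier := N\<rparr>\<^esub> a \<otimes> inv\<^bsub>G\<lparr>carrier := N\<rparr>\<^esub> b}) = ?S"
    by (intro SUP_cong refl) (use AN in \<open>auto simp: m_inv_consistent[OF sN] subset_iff\<close>)
  then have "commutator_subgroup (G\<lparr>carrier := N\<rparr>) N A = generate (G\<lparr>carrier := N\<rparr>) ?S"
    unfolding commutator_subgroup_def by simp
  also have "\<dots> = generate G ?S"
    using SA AN by (intro generate_consistent sN) auto
  finally have eq: "commutator_subgroup (G\<lparr>carrier := N\<rparr>) N A = generate G ?S" .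
  show "commutator_subgroup (G\<lparr>carrier := N\<rparr>) N A \<subseteq> A"
    unfolding eq by (rule generate_subgroup_incl[OF SA sA])
  show "commutator_subgroup (G\<lparr>carrier := N\<rparr>) N A \<lhd> G"
    unfolding eq
  proof (rule normal_generateI)
    show "?S \<subseteq> carrier G" using SA subgroup.subset[OF sA] by auto
    fix h g assume "h \<in> ?S" and g: "g \<in> carrier G"
    then obtain a b where ab: "a \<in> N" "b \<in> A" "h = a \<otimes> b \<otimes> inv a \<otimes> inv b" by auto
    have "g \<otimes> h \<otimes> inv g = (g \<otimes> a \<otimes> inv g) \<otimes> (g \<otimes> b \<otimes> inv g)
        \<otimes> inv (g \<otimes> a \<otimes> inv g) \<otimes> inv (g \<otimes> b \<otimes> inv g)"
      unfolding ab(3) using ab g sN sA by (intro conj_commutator) (auto dest: subgroup.mem_carrier)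
    then show "g \<otimes> h \<otimes> inv g \<in> ?S"
      using normal_conj_closed[OF N g ab(1)] normal_conj_closed[OF A g ab(2)] by blast
  qed
qed

text \<open>
  Normality holds in all of \<open>G\<close>, not only in \<open>N\<close>: conjugation by elements outside \<open>N\<close>
  maps each term of the series to itself, and thus acts on the factors.
\<close>

lemma lower_central_normal:
  assumes N: "N \<lhd> G"
  shows "lower_central (G\<lparr>carrier := N\<rparr>) j \<lhd> G \<and> lower_central (G\<lparr>carrier := N\<rparr>) j \<subseteq> N"
proof (induction j)
  case 0
  then show ?case using N by simp
next
  case (Suc j)
  then show ?case using commutator_subgroup_normal[OF N, of "lower_central (G\<lparr>carrier := N\<rparr>) j"] by auto
qed

text \<open>
  Cosets and their products are the same whether formed in \<open>G\<close> or in a subgroup, so that the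
  factors can be computed in \<open>G\<close>.
\<close>

lemma central_factor_restrict:
  shows "carrier (central_factor (G\<lparr>carrier := N\<rparr>) j) =
      (\<lambda>a. lower_central (G\<lparr>carrier := N\<rparr>) (Suc j) #> a) ` lower_central (G\<lparr>carrier := N\<rparr>) j"
    and "A \<otimes>\<^bsub>central_factor (G\<lparr>carrier := N\<rparr>) j\<^esub> B = A <#> B"
  unfolding central_factor_def FactGroup_def RCOSETS_def r_coset_def set_mult_def by auto

section \<open>All elements of the coset are conjugate\<close>

text \<open>
  One step down the central series. The element \<open>u\<close> solves \<open>f u = u + a\<close> on the factor, and
  conjugating by \<open>x u x\<inverse>\<close> rather than by \<open>u\<close> makes the factors \<open>x\<close> cancel.
\<close>

lemma conj_into_next_term:
  assumes N: "N \<lhd> G" and x: "x \<in> carrier G"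
    and fd: "vectorspace.fin_dim F (factor_space (G\<lparr>carrier := N\<rparr>) s j)"
    and lin: "linear_map F (factor_space (G\<lparr>carrier := N\<rparr>) s j)
                (factor_space (G\<lparr>carrier := N\<rparr>) s j) (\<lambda>W. conj_action G x ` W)"
    and nofix: "\<And>W. W \<in> carrier (central_factor (G\<lparr>carrier := N\<rparr>) j) \<Longrightarrow>
                conj_action G x ` W = W \<Longrightarrow> W = \<one>\<^bsub>central_factor (G\<lparr>carrier := N\<rparr>) j\<^esub>"
    and a: "a \<in> lower_central (G\<lparr>carrier := N\<rparr>) j"
  shows "\<exists>m\<in>N. \<exists>b\<in>lower_central (G\<lparr>carrier := N\<rparr>) (Suc j).
           m \<otimes> (x \<otimes> a) \<otimes> inv m = x \<otimes> b"
proof -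
  let ?V = "factor_space (G\<lparr>carrier := N\<rparr>) s j"
  let ?L = "lower_central (G\<lparr>carrier := N\<rparr>) j"
  define M where "M = lower_central (G\<lparr>carrier := N\<rparr>) (Suc j)"
  have M: "M \<lhd> G" unfolding M_def using lower_central_normal[OF N, of "Suc j"] by blast
  interpret M: normal M G by (rule M)
  have L: "?L \<lhd> G" "?L \<subseteq> N" using lower_central_normal[OF N] by auto
  have LG: "?L \<subseteq> carrier G" using normal_imp_subgroup[OF L(1)] subgroup.subset by blast
  have carr: "carrier ?V = (\<lambda>a. M #> a) ` ?L"
    by (simp add: factor_space_def Let_def central_factor_restrict M_def)
  have add: "A \<oplus>\<^bsub>?V\<^esub> B = A <#> B" for A B
    by (simp add: factor_space_def Let_def central_factor_restrict)
  have "\<exists>U\<in>carrier ?V. conj_action G x ` U = U \<oplus>\<^bsub>?V\<^esub> (M #> a)"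
    by (rule fixed_point_free_imp_displacement_surj[OF lin fd])
       (use nofix a in \<open>auto simp: carr, auto simp: factor_space_def Let_def central_factor_restrict M_def\<close>)
  then obtain u where u: "u \<in> ?L" and eq: "conj_action G x ` (M #> u) = (M #> u) <#> (M #> a)"
    unfolding add unfolding carr by auto
  have uG: "u \<in> carrier G" and aG: "a \<in> carrier G" using u a LG by auto
  define m where "m = x \<otimes> u \<otimes> inv x"
  have mN: "m \<in> N" and mG: "m \<in> carrier G"
    using normal_conj_closed[OF L(1) x u] L(2) LG by (auto simp: m_def)
  have "m \<in> conj_action G x ` (M #> u)"
    unfolding m_def conj_action_def using rcos_self[OF uG M.subgroup_axioms] by blast
  then have "m \<in> M #> (u \<otimes> a)" unfolding eq M.rcos_sum[OF uG aG] .
  then obtain l where l: "l \<in> M" and ml: "m = l \<otimes> (u \<otimes> a)" unfolding r_coset_def by auto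
  have lG: "l \<in> carrier G" using l by (rule M.mem_carrier)
  have "u \<otimes> a = inv l \<otimes> m" unfolding ml using lG uG aG by (simp add: inv_cancel_left)
  have "m \<otimes> (x \<otimes> a) \<otimes> inv m = x \<otimes> (u \<otimes> a) \<otimes> inv m"
    unfolding m_def using x uG aG by (simp add: m_assoc inv_cancel_left inv_mult_group)
  also have "\<dots> = x \<otimes> inv l"
    unfolding \<open>u \<otimes> a = inv l \<otimes> m\<close> using x lG mG by (simp add: m_assoc)
  finally show ?thesis using mN M.m_inv_closed[OF l] unfolding M_def by blast
qed

lemma conjugate_in_conj_trans:
  assumes "m \<in> carrier G" "a \<in> carrier G" "conjugate_in G (m \<otimes> a \<otimes> inv m) b"
  shows "conjugate_in G a b"
proof -
  obtain h where h: "h \<in> carrier G" "b = h \<otimes> (m \<otimes> a \<otimes> inv m) \<otimes> inv h"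
    using assms(3) unfolding conjugate_in_def by auto
  then have "b = (h \<otimes> m) \<otimes> a \<otimes> inv (h \<otimes> m)" using assms by (simp add: m_assoc inv_mult_group)
  then show ?thesis unfolding conjugate_in_def using h assms by blast
qed

lemma conjugate_in_sym:
  assumes "a \<in> carrier G" "conjugate_in G a b"
  shows "conjugate_in G b a"
proof -
  obtain h where h: "h \<in> carrier G" "b = h \<otimes> a \<otimes> inv h"
    using assms(2) unfolding conjugate_in_def by auto
  then have "a = inv h \<otimes> b \<otimes> inv (inv h)" using assms(1) by (simp add: m_assoc inv_cancel_left)
  then show ?thesis unfolding conjugate_in_def using h by blast
qed

lemma conjugate_in_trans:
  assumes "a \<in> carrier G" "conjugate_in G a b" "conjugate_in G b c"
  shows "conjugate_in G a c"
  using assms conjugate_in_conj_trans unfolding conjugate_in_def[of G a b] by blast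

text \<open>
  The proof iterates the single step until the error term \<open>a\<close> is trivial. The induction is on
  the number \<open>i\<close> of steps that remain, so it starts at the bottom of the central series.
\<close>

lemma coset_element_conjugate:
  assumes N: "N \<lhd> G" and x: "x \<in> carrier G"
    and nil: "F_nilpotent F (G\<lparr>carrier := N\<rparr>) s"
    and lin: "F_linear_action F G (G\<lparr>carrier := N\<rparr>) s (conj_action G)"
    and nofix: "no_nonzero_fixed_points (G\<lparr>carrier := N\<rparr>) (conj_action G x)"
    and n: "n \<in> N"
  shows "conjugate_in G (x \<otimes> n) x"
proof -
  let ?r = "nilpotency_class (G\<lparr>carrier := N\<rparr>)"
  let ?L = "lower_central (G\<lparr>carrier := N\<rparr>)"
  have NG: "N \<subseteq> carrier G" using N by (meson normal_imp_subgroup subgroup.subset)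
  have "\<exists>r. ?L r = {\<one>}"
    using nil unfolding F_nilpotent_def nilpotent_group_def by simp
  then have Lr: "?L ?r = {\<one>}"
    using LeastI_ex[of "\<lambda>r. ?L r = {\<one>}"] unfolding nilpotency_class_def by simp
  have "conjugate_in G (x \<otimes> a) x" if "i \<le> ?r" "a \<in> ?L (?r - i)" for i a
    using that
  proof (induction i arbitrary: a)
    case 0
    then have "x = \<one> \<otimes> (x \<otimes> a) \<otimes> inv \<one>" using Lr x by simp
    then show ?case unfolding conjugate_in_def by blast
  next
    case (Suc i)
    let ?j = "?r - Suc i"
    have j: "?j < ?r" "Suc ?j = ?r - i" using Suc.prems by auto
    have aG: "a \<in> carrier G" using lower_central_normal[OF N] Suc.prems NG by blast
    have "\<exists>m\<in>N. \<exists>b\<in>?L (Suc ?j). m \<otimes> (x \<otimes> a) \<otimes> inv m = x \<otimes> b"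
    proof (rule conj_into_next_term[OF N x _ _ _ Suc.prems(2)])
      show "vectorspace.fin_dim F (factor_space (G\<lparr>carrier := N\<rparr>) s ?j)"
        using nil j unfolding F_nilpotent_def by blast
      show "linear_map F (factor_space (G\<lparr>carrier := N\<rparr>) s ?j)
              (factor_space (G\<lparr>carrier := N\<rparr>) s ?j) (\<lambda>W. conj_action G x ` W)"
        using lin j x unfolding F_linear_action_def by blast
      show "W = \<one>\<^bsub>central_factor (G\<lparr>carrier := N\<rparr>) ?j\<^esub>"
        if "W \<in> carrier (central_factor (G\<lparr>carrier := N\<rparr>) ?j)" "conj_action G x ` W = W" for W
        using nofix j that unfolding no_nonzero_fixed_points_def by blast
    qed
    then obtain m b where mb: "m \<in> N" "b \<in> ?L (?r - i)" "m \<otimes> (x \<otimes> a) \<otimes> inv m = x \<otimes> b"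
      unfolding j(2) by blast
    have "conjugate_in G (x \<otimes> b) x" using Suc.IH mb(2) Suc.prems(1) by simp
    then show ?case using conjugate_in_conj_trans[of m "x \<otimes> a" x] mb NG x aG by auto
  qed
  from this[of ?r n] n show ?thesis by simp
qed

section \<open>Transfer along conjugation and from a subgroup\<close>

lemma conj_image_generate_singleton:
  assumes h: "h \<in> carrier G" and g: "g \<in> carrier G"
  shows "generate G {h \<otimes> g \<otimes> inv h} = (\<lambda>z. h \<otimes> z \<otimes> inv h) ` generate G {g}"
proof -
  interpret c: group_hom G G "\<lambda>z. h \<otimes> z \<otimes> inv h"
    by (intro group_hom.intro group_hom_axioms.intro is_group)
       (use h in \<open>auto simp: hom_def m_assoc inv_cancel_left\<close>)
  show ?thesis using c.generate_img[of "{g}"] g by simp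
qed

lemma real_in_conjugate:
  assumes a: "real_in G a" and b: "b \<in> carrier G" and ba: "conjugate_in G b a"
  shows "real_in G b"
proof -
  have aG: "a \<in> carrier G" using a unfolding real_in_def by blast
  obtain h where h: "h \<in> carrier G" "b = h \<otimes> a \<otimes> inv h"
    using conjugate_in_sym[OF b ba] unfolding conjugate_in_def by auto
  have "inv b = h \<otimes> inv a \<otimes> inv h" using h aG by (simp add: inv_mult_group m_assoc)
  then have "conjugate_in G (inv a) (inv b)" unfolding conjugate_in_def using h(1) by blast
  moreover have "conjugate_in G b (inv a)"
    using conjugate_in_trans[OF b ba] a unfolding real_in_def by blast
  ultimately show ?thesis using conjugate_in_trans[OF b] b unfolding real_in_def by blast
qed

text \<open>
  If \<open>y\<close> generates the same cyclic group as \<open>b\<close>, then the conjugation taking \<open>b\<close> to \<open>a\<close>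
  takes \<open>y\<close> to a generator of the cyclic group of \<open>a\<close>.
\<close>

lemma rational_in_conjugate:
  assumes a: "rational_in G a" and b: "b \<in> carrier G" and ba: "conjugate_in G b a"
  shows "rational_in G b"
  unfolding rational_in_def
proof (intro conjI ballI impI b)
  fix y assume y: "y \<in> carrier G" and gen: "generate G {y} = generate G {b}"
  obtain h where h: "h \<in> carrier G" "a = h \<otimes> b \<otimes> inv h"
    using ba unfolding conjugate_in_def by auto
  have "generate G {h \<otimes> y \<otimes> inv h} = generate G {a}"
    unfolding h(2) conj_image_generate_singleton[OF h(1) y]
      conj_image_generate_singleton[OF h(1) b] gen ..
  then have "conjugate_in G (h \<otimes> y \<otimes> inv h) a"
    using a h y unfolding rational_in_def by auto
  then have "conjugate_in G y a" by (rule conjugate_in_conj_trans[OF h(1) y])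
  then show "conjugate_in G y b" using conjugate_in_trans[OF y] conjugate_in_sym[OF b ba] by blast
qed

lemma conjugate_in_subgroup:
  assumes "subgroup H G" "conjugate_in (G\<lparr>carrier := H\<rparr>) a b"
  shows "conjugate_in G a b"
  using assms subgroup.mem_carrier[OF assms(1)] unfolding conjugate_in_def
  by (auto simp: m_inv_consistent)

lemma real_in_subgroup:
  assumes H: "subgroup H G" and x: "real_in (G\<lparr>carrier := H\<rparr>) x"
  shows "real_in G x"
  using x subgroup.mem_carrier[OF H] conjugate_in_subgroup[OF H] unfolding real_in_def
  by (auto simp: m_inv_consistent[OF H])

text \<open>
  Rationality passes up because an element generating the same cyclic group as \<open>x\<close> is forced
  to lie in \<open>H\<close>: the larger group offers no further elements to compare with.
\<close>

lemma rational_in_subgroup: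
  assumes H: "subgroup H G" and x: "rational_in (G\<lparr>carrier := H\<rparr>) x"
  shows "rational_in G x"
  unfolding rational_in_def
proof (intro conjI ballI impI)
  have xH: "x \<in> H" using x unfolding rational_in_def by simp
  then show "x \<in> carrier G" using subgroup.mem_carrier[OF H] by blast
  fix y assume gen: "generate G {y} = generate G {x}"
  have "y \<in> generate G {x}" unfolding gen[symmetric] by (simp add: generate.incl)
  then have yH: "y \<in> H" using generate_subgroup_incl[of "{x}", OF _ H] xH by auto
  have "generate (G\<lparr>carrier := H\<rparr>) {y} = generate (G\<lparr>carrier := H\<rparr>) {x}"
    using gen generate_consistent[OF _ H] xH yH by simp
  then show "conjugate_in G y x"
    using x yH conjugate_in_subgroup[OF H] unfolding rational_in_def by auto
qed

end

section \<open>Real and rational elements of the semidirect product\<close>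

theorem theorem1p3:
  fixes F :: "('f, 'm) ring_scheme"
    and G :: "('g, 'k) monoid_scheme"
    and H N :: "'g set"
    and s :: "nat \<Rightarrow> 'f \<Rightarrow> 'g set \<Rightarrow> 'g set"
    and x :: 'g
  assumes "field F"
    and "group G"
    and "internal_semidirect G H N"
    and "F_nilpotent F (G\<lparr>carrier := N\<rparr>) s"
    and "F_linear_action F G (G\<lparr>carrier := N\<rparr>) s (conj_action G)"
    and "x \<in> H"
    and "x \<noteq> \<one>\<^bsub>G\<^esub>"
    and "no_nonzero_fixed_points (G\<lparr>carrier := N\<rparr>) (conj_action G x)"
  shows "(real_in (G\<lparr>carrier := H\<rparr>) x \<longrightarrow> (\<forall>n\<in>N. real_in G (x \<otimes>\<^bsub>G\<^esub> n))) \<and>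
         (rational_in (G\<lparr>carrier := H\<rparr>) x \<longrightarrow> (\<forall>n\<in>N. rational_in G (x \<otimes>\<^bsub>G\<^esub> n)))"
proof -
  interpret group G by (rule assms(2))
  have H: "subgroup H G" and N: "N \<lhd> G" using assms(3) unfolding internal_semidirect_def by auto
  have x: "x \<in> carrier G" using subgroup.mem_carrier[OF H assms(6)] .
  have xn: "x \<otimes>\<^bsub>G\<^esub> n \<in> carrier G" "conjugate_in G (x \<otimes>\<^bsub>G\<^esub> n) x" if "n \<in> N" for n
    using that x subgroup.mem_carrier[OF normal_imp_subgroup[OF N]]
      coset_element_conjugate[OF N x assms(4,5,8)] by auto
  show ?thesis
    using xn real_in_conjugate[OF real_in_subgroup[OF H]]
      rational_in_conjugate[OF rational_in_subgroup[OF H]] by blast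
qed

end
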